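(* Let $r\ge0$ and let $H(t)$, $t\in I$, be a family of symmetric operators on $\mathcal H$ with $\mathcal H^\infty\subset D(H(t))$ for all $t$ and $t\mapsto H(t)u$ continuous from $I$ to $\mathcal H$ for every $u\in\mathcal H^\infty$. Assume there is a locally integrable function $c_r:I\to[0,\infty)$ such that $$\left|\mathrm i\left(\langle H(t)v,\Lambda^{2r}v\rangle-\langle\Lambda^{2r}v,H(t)v\rangle\right)\right|\le c_r(t)\|v\|_r^2$$ for every $v\in\mathcal H^\infty$ and almost every $t\in I$. Then, for every $N>0$, every $v\in\mathcal H_N$ and every $s,t\in I$, $$\|U_N(t,s)v\|_r\le\exp\left(\frac12\int_{\min(s,t)}^{\max(s,t)}c_r(\tau)\,d\tau\right)\|v\|_r .$$ In particular, the stability constant is independent of $N$.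
   Context: $\mathcal H$ is a complex separable Hilbert space, $H_0$ a positive self-adjoint operator on $\mathcal H$ with compact resolvent (spectrum contained in $[0,\infty)$), $\Lambda=1+H_0$, and $I\subset\mathbb R$ is a time interval. For $N>0$, $P_N=\mathbf 1_{[0,N]}(H_0)$ and $\mathcal H_N=P_N\mathcal H$ (finite-dimensional). For $r\ge0$, $\mathcal H^r=D(\Lambda^r)$ with norm $\|u\|_r=\|\Lambda^ru\|$, and $\mathcal H^\infty=\bigcap_{r\ge0}\mathcal H^r$. $H_N(t)=P_NH(t)P_N$ is viewed as a self-adjoint operator on $\mathcal H_N$, and $U_N(t,s)$ is its unitary propagator: $\mathrm i\partial_tU_N(t,s)=H_N(t)U_N(t,s)$, $U_N(s,s)=\mathbf 1_{\mathcal H_N}$. *)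

theory Defs
  imports "HOL-Analysis.Analysis"
begin

text \<open>
  Complex Hilbert spaces; completeness comes from \<^class>\<open>banach\<close>, and the inner product is
  antilinear in its first argument.
\<close>

class complex_hilbert_space = banach +
  fixes scaleC :: "complex \<Rightarrow> 'a \<Rightarrow> 'a"  (infixr \<open>*\<^sub>C\<close> 75)
    and cinner :: "'a \<Rightarrow> 'a \<Rightarrow> complex"
  assumes scaleC_add_right: "a *\<^sub>C (x + y) = a *\<^sub>C x + a *\<^sub>C y"
    and scaleC_add_left: "(a + b) *\<^sub>C x = a *\<^sub>C x + b *\<^sub>C x"
    and scaleC_scaleC: "a *\<^sub>C (b *\<^sub>C x) = (a * b) *\<^sub>C x"
    and scaleC_complex_of_real: "complex_of_real c *\<^sub>C x = c *\<^sub>R x"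
    and cinner_commute: "cinner x y = cnj (cinner y x)"
    and cinner_add_right: "cinner x (y + z) = cinner x y + cinner x z"
    and cinner_scaleC_right: "cinner x (a *\<^sub>C y) = a * cinner x y"
    and cinner_self_eq_norm: "cinner x x = complex_of_real ((norm x)\<^sup>2)"

definition complex_subspace :: "'a::complex_hilbert_space set \<Rightarrow> bool" where
  "complex_subspace S \<longleftrightarrow>
     0 \<in> S \<and> (\<forall>x\<in>S. \<forall>y\<in>S. x + y \<in> S) \<and> (\<forall>a. \<forall>x\<in>S. a *\<^sub>C x \<in> S)"

definition complex_linear_on ::
    "'a::complex_hilbert_space set \<Rightarrow> ('a \<Rightarrow> 'a) \<Rightarrow> bool" where
  "complex_linear_on S T \<longleftrightarrow>
     (\<forall>x\<in>S. \<forall>y\<in>S. T (x + y) = T x + T y) \<and> (\<forall>a. \<forall>x\<in>S. T (a *\<^sub>C x) = a *\<^sub>C T x)"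

text \<open>
  A possibly unbounded operator is a domain together with a function; the values of the
  function outside the domain carry no meaning.
\<close>

datatype 'a operator = Operator (dom_op: "'a set") (app_op: "'a \<Rightarrow> 'a")

definition symmetric_op :: "'a::complex_hilbert_space operator \<Rightarrow> bool" where
  "symmetric_op A \<longleftrightarrow>
     complex_subspace (dom_op A) \<and> complex_linear_on (dom_op A) (app_op A) \<and>
     closure (dom_op A) = UNIV \<and>
     (\<forall>x\<in>dom_op A. \<forall>y\<in>dom_op A. cinner (app_op A x) y = cinner x (app_op A y))"

definition graph_op :: "'a operator \<Rightarrow> ('a \<times> 'a) set" where
  "graph_op A = {(x, app_op A x) | x. x \<in> dom_op A}"

definition adjoint_graph :: "'a::complex_hilbert_space operator \<Rightarrow> ('a \<times> 'a) set" where
  "adjoint_graph A = {(y, z). \<forall>x\<in>dom_op A. cinner y (app_op A x) = cinner z x}"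

definition self_adjoint_op :: "'a::complex_hilbert_space operator \<Rightarrow> bool" where
  "self_adjoint_op A \<longleftrightarrow>
     complex_subspace (dom_op A) \<and> complex_linear_on (dom_op A) (app_op A) \<and>
     closure (dom_op A) = UNIV \<and> graph_op A = adjoint_graph A"

definition positive_op :: "'a::complex_hilbert_space operator \<Rightarrow> bool" where
  "positive_op A \<longleftrightarrow>
     (\<forall>x\<in>dom_op A. cinner x (app_op A x) \<in> complex_of_real ` {0..})"

definition resolvent_set :: "'a::complex_hilbert_space operator \<Rightarrow> complex set" where
  "resolvent_set A =
     {z. bij_betw (\<lambda>x. app_op A x - z *\<^sub>C x) (dom_op A) UNIV \<and>
         (\<exists>K. \<forall>x\<in>dom_op A. norm x \<le> K * norm (app_op A x - z *\<^sub>C x))}"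

definition spectrum_op :: "'a::complex_hilbert_space operator \<Rightarrow> complex set" where
  "spectrum_op A = - resolvent_set A"

definition resolvent :: "'a::complex_hilbert_space operator \<Rightarrow> complex \<Rightarrow> 'a \<Rightarrow> 'a" where
  "resolvent A z = inv_into (dom_op A) (\<lambda>x. app_op A x - z *\<^sub>C x)"

definition compact_map :: "('a::complex_hilbert_space \<Rightarrow> 'a) \<Rightarrow> bool" where
  "compact_map T \<longleftrightarrow> (\<forall>B. bounded B \<longrightarrow> compact (closure (T ` B)))"

definition compact_resolvent :: "'a::complex_hilbert_space operator \<Rightarrow> bool" where
  "compact_resolvent A \<longleftrightarrow> (\<exists>z\<in>resolvent_set A. compact_map (resolvent A z))"

text \<open>
  Functional calculus. A self-adjoint operator with compact resolvent has pure point spectrum,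
  so its spectral measure is \<open>E(B) = \<Sum>\<lambda>\<in>B. E\<^sub>\<lambda>\<close>, where \<open>E\<^sub>\<lambda>\<close> is the orthogonal projection onto
  the eigenspace of \<open>\<lambda>\<close> and \<open>\<lambda>\<close> ranges over the eigenvalues, all of them real. Hence
  \<open>f(A)u = \<Sum>\<lambda>. f(\<lambda>) E\<^sub>\<lambda> u\<close> on the domain of those \<open>u\<close> for which
  \<open>\<integral> \<bar>f\<bar>\<^sup>2 d\<parallel>E u\<parallel>\<^sup>2 = \<Sum>\<lambda>. \<bar>f(\<lambda>)\<bar>\<^sup>2 \<parallel>E\<^sub>\<lambda> u\<parallel>\<^sup>2\<close> is finite. The definition below is meant
  for such operators only.
\<close>

definition eigenspace :: "'a::complex_hilbert_space operator \<Rightarrow> real \<Rightarrow> 'a set" where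
  "eigenspace A l = {x \<in> dom_op A. app_op A x = complex_of_real l *\<^sub>C x}"

definition eigenvalues :: "'a::complex_hilbert_space operator \<Rightarrow> real set" where
  "eigenvalues A = {l. \<exists>x\<in>eigenspace A l. x \<noteq> 0}"

definition orth_proj :: "'a::complex_hilbert_space set \<Rightarrow> 'a \<Rightarrow> 'a" where
  "orth_proj S x = (THE p. p \<in> S \<and> (\<forall>y\<in>S. cinner y (x - p) = 0))"

definition fun_calc ::
    "(real \<Rightarrow> real) \<Rightarrow> 'a::complex_hilbert_space operator \<Rightarrow> 'a operator" where
  "fun_calc f A = Operator
     {x. (\<lambda>l. (f l)\<^sup>2 * (norm (orth_proj (eigenspace A l) x))\<^sup>2) summable_on eigenvalues A}
     (\<lambda>x. \<Sum>\<^sub>\<infinity>l\<in>eigenvalues A. f l *\<^sub>R orth_proj (eigenspace A l) x)"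

definition Lambda :: "'a::complex_hilbert_space operator \<Rightarrow> 'a operator" where
  "Lambda H0 = Operator (dom_op H0) (\<lambda>x. x + app_op H0 x)"

definition Lambda_pow :: "'a::complex_hilbert_space operator \<Rightarrow> real \<Rightarrow> 'a operator" where
  "Lambda_pow H0 r = fun_calc (\<lambda>x. x powr r) (Lambda H0)"

definition sobolev_space :: "'a::complex_hilbert_space operator \<Rightarrow> real \<Rightarrow> 'a set" where
  "sobolev_space H0 r = dom_op (Lambda_pow H0 r)"

definition sobolev_norm :: "'a::complex_hilbert_space operator \<Rightarrow> real \<Rightarrow> 'a \<Rightarrow> real" where
  "sobolev_norm H0 r x = norm (app_op (Lambda_pow H0 r) x)"

definition smooth_space :: "'a::complex_hilbert_space operator \<Rightarrow> 'a set" where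
  "smooth_space H0 = (\<Inter>r\<in>{0..}. sobolev_space H0 r)"

definition spectral_proj :: "'a::complex_hilbert_space operator \<Rightarrow> real \<Rightarrow> 'a \<Rightarrow> 'a" where
  "spectral_proj H0 N = app_op (fun_calc (indicator {0..N}) H0)"

definition trunc_space :: "'a::complex_hilbert_space operator \<Rightarrow> real \<Rightarrow> 'a set" where
  "trunc_space H0 N = range (spectral_proj H0 N)"

definition trunc_hamiltonian ::
    "'a::complex_hilbert_space operator \<Rightarrow> (real \<Rightarrow> 'a operator) \<Rightarrow> real \<Rightarrow> real \<Rightarrow> 'a \<Rightarrow> 'a" where
  "trunc_hamiltonian H0 H N t x = spectral_proj H0 N (app_op (H t) (spectral_proj H0 N x))"

definition unitary_on :: "'a::complex_hilbert_space set \<Rightarrow> ('a \<Rightarrow> 'a) \<Rightarrow> bool" where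
  "unitary_on W T \<longleftrightarrow>
     complex_linear_on W T \<and> bij_betw T W W \<and> (\<forall>x\<in>W. \<forall>y\<in>W. cinner (T x) (T y) = cinner x y)"

text \<open>
  \<open>U t s\<close> is the propagator on \<open>W\<close> of \<open>\<i> \<partial>\<^sub>t U(t,s) = h(t) U(t,s)\<close>, \<open>U(s,s) = 1\<close>. The
  derivative is taken on each vector, which for finite-dimensional \<open>W\<close> amounts to the
  derivative in operator norm. At an end point of \<open>I\<close> the derivative
  is one-sided.
\<close>

definition unitary_propagator ::
    "real set \<Rightarrow> 'a::complex_hilbert_space set \<Rightarrow> (real \<Rightarrow> 'a \<Rightarrow> 'a) \<Rightarrow>
     (real \<Rightarrow> real \<Rightarrow> 'a \<Rightarrow> 'a) \<Rightarrow> bool" where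
  "unitary_propagator I W h U \<longleftrightarrow>
     (\<forall>s\<in>I. \<forall>t\<in>I. unitary_on W (U t s)) \<and>
     (\<forall>s\<in>I. \<forall>v\<in>W. U s s v = v) \<and>
     (\<forall>s\<in>I. \<forall>t\<in>I. \<forall>v\<in>W. \<exists>D.
        ((\<lambda>\<tau>. U \<tau> s v) has_vector_derivative D) (at t within I) \<and>
        \<i> *\<^sub>C D = h t (U t s v))"

definition locally_integrable_on :: "(real \<Rightarrow> real) \<Rightarrow> real set \<Rightarrow> bool" where
  "locally_integrable_on c I \<longleftrightarrow>
     (\<forall>K. compact K \<and> K \<subseteq> I \<longrightarrow> c absolutely_integrable_on K)"

end

theory Submission
  imports Defs
begin

text \<open>
  The resolvent is compact, so \<open>\<H>\<^sub>N\<close> has a finite orthonormal basis \<open>B\<close> of eigenvectors of \<open>H\<^sub>0\<close>. In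
  the coordinates \<open>x e = \<langle>e, U(t,s)v\<rangle>\<close> the squared Sobolev norm becomes
  \<open>S = \<Sum>e\<in>B. (1 + ev e)\<^sup>2\<^sup>r \<bar>x e\<bar>\<^sup>2\<close>. Its derivative is continuous in \<open>t\<close> and equals the commutator form at
  \<open>U(t,s)v\<close>, because \<open>P\<^sub>N\<close> commutes with \<open>\<Lambda>\<close>. The hypothesis bounds that form for almost every \<open>t\<close>
  with a null set depending on the vector; a countable dense set of coordinates gives one null
  set for all of \<open>\<H>\<^sub>N\<close>. Then \<open>\<bar>(ln S)'\<bar> \<le> c\<close> almost everywhere, and integrating gives the estimate in
  both time directions.
\<close>

section \<open>Algebra of the complex inner product, and the Cauchy-Schwarz inequality\<close>

lemma scaleC_zero_left [simp]: "0 *\<^sub>C (x::'a::complex_hilbert_space) = 0"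
  using scaleC_complex_of_real[of 0 x] by simp

lemma scaleC_zero_right [simp]: "a *\<^sub>C (0::'a::complex_hilbert_space) = 0"
  using scaleC_add_right[of a "0::'a" 0] by simp

lemma scaleC_one [simp]: "1 *\<^sub>C (x::'a::complex_hilbert_space) = x"
  using scaleC_complex_of_real[of 1 x] by simp

lemma scaleC_minus_one: "(-1) *\<^sub>C (x::'a::complex_hilbert_space) = - x"
  using scaleC_complex_of_real[of "-1" x] by simp

lemma scaleC_diff_left:
  "(a - b) *\<^sub>C (x::'a::complex_hilbert_space) = a *\<^sub>C x - b *\<^sub>C x"
  using scaleC_add_left[of "a - b" b x] by (simp add: eq_diff_eq)

lemma cinner_add_left:
  "cinner (x + y) z = cinner x z + cinner (y::'a::complex_hilbert_space) z"
  by (metis cinner_add_right cinner_commute complex_cnj_add)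

lemma cinner_scaleC_left:
  "cinner (a *\<^sub>C x) y = cnj a * cinner (x::'a::complex_hilbert_space) y"
  by (metis cinner_scaleC_right cinner_commute complex_cnj_mult)

lemma cinner_zero_right [simp]: "cinner (x::'a::complex_hilbert_space) 0 = 0"
  using cinner_scaleC_right[of x 0 0] by simp

lemma cinner_zero_left [simp]: "cinner 0 (x::'a::complex_hilbert_space) = 0"
  using cinner_scaleC_left[of 0 0 x] by simp

lemma cinner_diff_right:
  "cinner x (y - z) = cinner x y - cinner (x::'a::complex_hilbert_space) z"
  using cinner_add_right[of x "y - z" z] by (simp add: eq_diff_eq)

lemma cinner_diff_left:
  "cinner (x - y) z = cinner x z - cinner (y::'a::complex_hilbert_space) z"
  using cinner_add_left[of "x - y" y z] by (simp add: eq_diff_eq)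

lemma cinner_sum_right:
  "cinner x (\<Sum>i\<in>A. f i) = (\<Sum>i\<in>A. cinner (x::'a::complex_hilbert_space) (f i))"
  by (induction A rule: infinite_finite_induct) (auto simp: cinner_add_right)

lemma cinner_sum_left:
  "cinner (\<Sum>i\<in>A. f i) x = (\<Sum>i\<in>A. cinner (f i) (x::'a::complex_hilbert_space))"
  by (induction A rule: infinite_finite_induct) (auto simp: cinner_add_left)

lemma cinner_self_eq_0_iff: "cinner x x = 0 \<longleftrightarrow> (x::'a::complex_hilbert_space) = 0"
  by (simp add: cinner_self_eq_norm)

text \<open>The class ties the norm directly to real scalars only; complex homogeneity comes from
  pulling \<open>a * cnj a\<close> out of
  \<open>cinner (a *\<^sub>C x) (a *\<^sub>C x)\<close>.\<close>

lemma norm_scaleC: "norm (a *\<^sub>C (x::'a::complex_hilbert_space)) = cmod a * norm x"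
proof -
  have "complex_of_real ((norm (a *\<^sub>C x))\<^sup>2) = (a * cnj a) * cinner x x"
    unfolding cinner_self_eq_norm[symmetric]
    by (simp add: cinner_scaleC_left cinner_scaleC_right)
  also have "\<dots> = complex_of_real ((cmod a * norm x)\<^sup>2)"
    by (simp only: cinner_self_eq_norm complex_norm_square[symmetric] of_real_mult[symmetric]
        power_mult_distrib)
  finally have "complex_of_real ((norm (a *\<^sub>C x))\<^sup>2) = complex_of_real ((cmod a * norm x)\<^sup>2)" .
  then show ?thesis
    by (simp only: of_real_eq_iff power2_eq_iff_nonneg norm_ge_zero mult_nonneg_nonneg)
qed

lemma complex_Cauchy_Schwarz:
  "cmod (cinner x y) \<le> norm x * norm (y::'a::complex_hilbert_space)"
proof (cases "x = 0")
  case False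
  define n where "n = norm x"
  have n: "n > 0" using False by (simp add: n_def)
  \<comment> \<open>This is \<open>n\<^sup>2\<close> times the component of \<open>y\<close>
    orthogonal to \<open>x\<close>, scaled to avoid division. That its squared norm is nonnegative
    is the inequality, up to the positive factor \<open>n\<^sup>2\<close>.\<close>
  define z where "z = of_real (n\<^sup>2) *\<^sub>C y - cinner x y *\<^sub>C x"
  have xz: "cinner x z = 0"
    by (simp add: z_def cinner_diff_right cinner_scaleC_right cinner_self_eq_norm n_def)
  have "complex_of_real ((norm z)\<^sup>2) = cinner (of_real (n\<^sup>2) *\<^sub>C y) z"
    unfolding cinner_self_eq_norm[symmetric]
    by (subst z_def) (simp add: cinner_diff_left cinner_scaleC_left xz)
  also have "\<dots> = of_real (n\<^sup>2) * (of_real (n\<^sup>2) * cinner y y - cinner x y * cinner y x)"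
    unfolding z_def cinner_diff_right cinner_scaleC_left cinner_scaleC_right
    by (simp only: complex_cnj_complex_of_real) (simp add: right_diff_distrib mult.left_commute)
  also have "cinner x y * cinner y x = of_real ((cmod (cinner x y))\<^sup>2)"
    by (metis cinner_commute complex_norm_square)
  also have "of_real (n\<^sup>2) * (of_real (n\<^sup>2) * cinner y y - of_real ((cmod (cinner x y))\<^sup>2)) =
      complex_of_real (n\<^sup>2 * ((n * norm y)\<^sup>2 - (cmod (cinner x y))\<^sup>2))"
    by (simp only: cinner_self_eq_norm power_mult_distrib of_real_mult of_real_diff)
  finally have "n\<^sup>2 * ((n * norm y)\<^sup>2 - (cmod (cinner x y))\<^sup>2) = (norm z)\<^sup>2"
    by (simp only: of_real_eq_iff)
  then have "0 \<le> n\<^sup>2 * ((n * norm y)\<^sup>2 - (cmod (cinner x y))\<^sup>2)" by simp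
  then have "(cmod (cinner x y))\<^sup>2 \<le> (n * norm y)\<^sup>2"
    using n by (simp add: zero_le_mult_iff)
  then show ?thesis unfolding n_def by (rule power2_le_imp_le) simp
qed simp

text \<open>Serves to carry derivatives and continuity in the Hilbert space over to
  coordinates.\<close>

lemma bounded_linear_cinner: "bounded_linear (cinner (x::'a::complex_hilbert_space))"
proof (rule bounded_linear_intro)
  fix y z :: 'a and a :: real
  show "cinner x (y + z) = cinner x y + cinner x z" by (rule cinner_add_right)
  show "cinner x (a *\<^sub>R y) = a *\<^sub>R cinner x y"
    unfolding scaleC_complex_of_real[symmetric] cinner_scaleC_right scaleR_conv_of_real ..
  show "norm (cinner x y) \<le> norm y * norm x"
    unfolding mult.commute[of "norm y"] by (rule complex_Cauchy_Schwarz)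
qed

section \<open>Subspaces, linear maps and orthogonal projections\<close>

lemma complex_subspace_diff:
  assumes "complex_subspace S" "x \<in> S" "y \<in> S"
  shows "x - y \<in> S"
proof -
  have "x + (-1) *\<^sub>C y \<in> S" using assms unfolding complex_subspace_def by blast
  then show ?thesis by (simp add: scaleC_minus_one)
qed

lemma complex_subspace_sum:
  assumes "complex_subspace S" "\<And>i. i \<in> A \<Longrightarrow> f i \<in> S"
  shows "(\<Sum>i\<in>A. a i *\<^sub>C f i) \<in> S"
  using assms(2)
  by (induction A rule: infinite_finite_induct) (use assms(1) in \<open>auto simp: complex_subspace_def\<close>)

lemma complex_linear_on_sum:
  assumes S: "complex_subspace S" and T: "complex_linear_on S T"
    and "\<And>i. i \<in> A \<Longrightarrow> f i \<in> S"
  shows "T (\<Sum>i\<in>A. a i *\<^sub>C f i) = (\<Sum>i\<in>A. a i *\<^sub>C T (f i))"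
proof -
  have "0 \<in> S" using S by (simp add: complex_subspace_def)
  then have T0: "T 0 = 0"
    using T unfolding complex_linear_on_def by (metis scaleC_zero_left)
  show ?thesis using assms(3)
  proof (induction A rule: infinite_finite_induct)
    case (insert i A)
    have "(\<Sum>i\<in>A. a i *\<^sub>C f i) \<in> S" using insert.prems by (intro complex_subspace_sum[OF S]) auto
    moreover have "a i *\<^sub>C f i \<in> S" "f i \<in> S" using S insert.prems by (auto simp: complex_subspace_def)
    ultimately show ?case using insert T by (simp add: complex_linear_on_def)
  qed (auto simp: T0)
qed

text \<open>Discharges the definite description in \<open>orth_proj\<close>: the difference of two
  candidates lies in \<open>S\<close> and is orthogonal to \<open>S\<close>, hence to itself, so it
  is zero.\<close>

lemma orth_proj_eqI:
  assumes S: "complex_subspace S" and p: "p \<in> S" "\<And>y. y \<in> S \<Longrightarrow> cinner y (x - p) = 0"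
  shows "orth_proj S x = p"
  unfolding orth_proj_def
proof (rule the_equality)
  fix q assume q: "q \<in> S \<and> (\<forall>y\<in>S. cinner y (x - q) = 0)"
  have d: "p - q \<in> S" using complex_subspace_diff[OF S] p q by blast
  have "cinner (p - q) ((x - q) - (x - p)) = 0"
    unfolding cinner_diff_right[of _ "x - q"] using d p q by simp
  then have "cinner (p - q) (p - q) = 0" by simp
  then show "q = p" by (simp add: cinner_self_eq_0_iff)
qed (use p in auto)

section \<open>Orthonormal sets\<close>

definition orthonormal_set :: "'a::complex_hilbert_space set \<Rightarrow> bool" where
  "orthonormal_set B \<longleftrightarrow> (\<forall>x\<in>B. \<forall>y\<in>B. cinner x y = (if x = y then 1 else 0))"

lemma orthonormal_set_norm:
  assumes "orthonormal_set B" "x \<in> B"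
  shows "norm x = 1"
proof -
  have "complex_of_real ((norm x)\<^sup>2) = 1"
    using assms cinner_self_eq_norm[of x] unfolding orthonormal_set_def by metis
  then have "(norm x)\<^sup>2 = 1" by (metis of_real_eq_1_iff)
  then show ?thesis by (simp add: power2_eq_1_iff) (metis norm_ge_zero le_minus_one_simps(3))
qed

lemma cinner_orthonormal_sum:
  assumes "orthonormal_set B" "finite A" "A \<subseteq> B" "x \<in> B"
  shows "cinner x (\<Sum>e\<in>A. a e *\<^sub>C e) = (if x \<in> A then a x else 0)"
proof -
  have "cinner x (\<Sum>e\<in>A. a e *\<^sub>C e) = (\<Sum>e\<in>A. if e = x then a e else 0)"
    unfolding cinner_sum_right
  proof (rule sum.cong[OF refl])
    fix e assume "e \<in> A"
    with assms show "cinner x (a e *\<^sub>C e) = (if e = x then a e else 0)"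
      unfolding orthonormal_set_def by (auto simp: cinner_scaleC_right)
  qed
  with assms(2) show ?thesis by (simp only: sum.delta)
qed

text \<open>Distinct orthonormal vectors are at distance sqrt 2, so a ball of radius 1/2 holds at
  most one of them, and finitely many such balls cover \<open>K\<close>. That \<open>n\<close>
  depends on \<open>K\<close> alone is what later permits choosing an orthonormal set of maximal
  size.\<close>

lemma orthonormal_card_bound:
  fixes K :: "'a::complex_hilbert_space set"
  assumes "compact K"
  obtains n where "\<And>B. orthonormal_set B \<Longrightarrow> B \<subseteq> K \<Longrightarrow> finite B \<and> card B \<le> n"
proof -
  obtain k where k: "finite k" "K \<subseteq> (\<Union>x\<in>k. ball x (1/2))"
    using assms unfolding compact_eq_totally_bounded by (metis zero_less_divide_1_iff zero_less_numeral)
  have "finite B \<and> card B \<le> card k" if B: "orthonormal_set B" "B \<subseteq> K" for B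
  proof -
    have "\<forall>b\<in>B. \<exists>x. x \<in> k \<and> dist x b < 1/2" using B k by (auto simp: subset_iff)
    then obtain g where g: "\<And>b. b \<in> B \<Longrightarrow> g b \<in> k \<and> dist (g b) b < 1/2" by metis
    have "inj_on g B"
    proof (rule inj_onI, rule ccontr)
      fix x y assume xy: "x \<in> B" "y \<in> B" "g x = g y" "x \<noteq> y"
      have "dist x y \<le> dist (g x) x + dist (g x) y" by (metis dist_commute dist_triangle)
      then have "dist x y < 1" using g[of x] g[of y] xy by simp
      moreover have "complex_of_real ((norm (x - y))\<^sup>2) = of_real 2"
        unfolding cinner_self_eq_norm[symmetric] using B xy
        by (auto simp: cinner_diff_left cinner_diff_right orthonormal_set_def)
      then have "(dist x y)\<^sup>2 = 2" unfolding dist_norm by (simp only: of_real_eq_iff)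
      ultimately show False
        using power_le_one[of "dist x y" 2] by simp
    qed
    moreover have "g ` B \<subseteq> k" using g by auto
    ultimately show ?thesis
      using k(1) by (meson card_inj_on_le finite_subset finite_imageD)
  qed
  with that show ?thesis by blast
qed

section \<open>Eigenspaces, and a finite eigenbasis of the truncated space\<close>

lemma self_adjoint_symmetric:
  assumes "self_adjoint_op A" "x \<in> dom_op A" "y \<in> dom_op A"
  shows "cinner (app_op A x) y = cinner x (app_op A y)"
proof -
  have "(x, app_op A x) \<in> adjoint_graph A"
    using assms unfolding self_adjoint_op_def graph_op_def by blast
  with assms(3) show ?thesis by (simp add: adjoint_graph_def)
qed

lemma complex_subspace_eigenspace:
  assumes "self_adjoint_op A"
  shows "complex_subspace (eigenspace A l)"
proof -
  have "complex_subspace (dom_op A)" "complex_linear_on (dom_op A) (app_op A)"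
    using assms by (auto simp: self_adjoint_op_def)
  moreover from this have "app_op A 0 = 0"
    unfolding complex_linear_on_def complex_subspace_def by (metis scaleC_zero_left)
  ultimately show ?thesis
    unfolding complex_subspace_def complex_linear_on_def eigenspace_def
    by (auto simp: scaleC_add_right scaleC_scaleC mult.commute)
qed

lemma eigenspace_orthogonal:
  assumes "self_adjoint_op A" "x \<in> eigenspace A k" "y \<in> eigenspace A l" "k \<noteq> l"
  shows "cinner x y = 0"
proof -
  have "cinner (app_op A x) y = cinner x (app_op A y)"
    using assms by (intro self_adjoint_symmetric) (auto simp: eigenspace_def)
  then have "(complex_of_real k - of_real l) * cinner x y = 0"
    using assms by (simp add: eigenspace_def cinner_scaleC_left cinner_scaleC_right algebra_simps)
  with assms show ?thesis by simp
qed

lemma eigenspace_Lambda: "eigenspace (Lambda H0) l = eigenspace H0 (l - 1)"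
proof -
  have "x + app_op H0 x = of_real l *\<^sub>C x \<longleftrightarrow> app_op H0 x = of_real (l - 1) *\<^sub>C x" for x
    by (auto simp: scaleC_diff_left of_real_diff eq_diff_eq add.commute)
  then show ?thesis by (auto simp: eigenspace_def Lambda_def)
qed

text \<open>A unit eigenvector \<open>x\<close> for \<open>l\<close> is the resolvent at
  \<open>z\<close> applied to \<open>(l - z) *\<^sub>C x\<close>, a vector of norm at most
  \<open>N + cmod z\<close>. So a single ball, with relatively compact image, serves all
  \<open>l\<close> in [0,N].\<close>

lemma unit_eigenvectors_relatively_compact:
  assumes "compact_resolvent A"
  obtains K where "compact K"
    "\<And>x l. x \<in> eigenspace A l \<Longrightarrow> l \<in> {0..N} \<Longrightarrow> norm x = 1 \<Longrightarrow> x \<in> K"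
proof -
  obtain z where z: "z \<in> resolvent_set A" "compact_map (resolvent A z)"
    using assms unfolding compact_resolvent_def by blast
  define K where "K = closure (resolvent A z ` cball 0 (N + cmod z))"
  have "compact K" using z(2) unfolding K_def compact_map_def by simp
  moreover have "x \<in> K" if x: "x \<in> eigenspace A l" "l \<in> {0..N}" "norm x = 1" for x l
  proof -
    have "inj_on (\<lambda>x. app_op A x - z *\<^sub>C x) (dom_op A)"
      using z(1) by (auto simp: resolvent_set_def bij_betw_def)
    moreover have "x \<in> dom_op A" using x by (simp add: eigenspace_def)
    ultimately have "x = resolvent A z (app_op A x - z *\<^sub>C x)"
      unfolding resolvent_def by (rule inv_into_f_f[symmetric])
    also have "app_op A x - z *\<^sub>C x = (of_real l - z) *\<^sub>C x"
      using x by (simp add: eigenspace_def scaleC_diff_left)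
    finally have *: "x = resolvent A z ((of_real l - z) *\<^sub>C x)" .
    have "cmod (of_real l - z) \<le> cmod (of_real l) + cmod z" by (rule norm_triangle_ineq4)
    also have "\<dots> \<le> N + cmod z" using x by simp
    finally have "(of_real l - z) *\<^sub>C x \<in> cball 0 (N + cmod z)"
      using x(3) by (simp add: norm_scaleC)
    then have "x \<in> resolvent A z ` cball 0 (N + cmod z)" using * by (rule rev_image_eqI)
    then show ?thesis unfolding K_def by (rule subsetD[OF closure_subset])
  qed
  ultimately show ?thesis using that by blast
qed

text \<open>\<open>complete\<close> speaks about single eigenspaces, because
  \<open>trunc_space\<close> is defined through the functional calculus; that \<open>B\<close> spans
  it is derived afterwards. Several elements of \<open>B\<close> may share a value of
  \<open>ev\<close>, which accounts for multiplicity.\<close>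

locale truncated_eigenbasis =
  fixes H0 :: "'a::complex_hilbert_space operator" and N :: real
    and B :: "'a set" and ev :: "'a \<Rightarrow> real"
  assumes self_adjoint: "self_adjoint_op H0"
    and finite_B: "finite B"
    and orthonormal_B: "orthonormal_set B"
    and ev: "\<And>e. e \<in> B \<Longrightarrow> e \<in> eigenspace H0 (ev e)" "\<And>e. e \<in> B \<Longrightarrow> ev e \<in> {0..N}"
    and complete: "\<And>l x. l \<in> {0..N} \<Longrightarrow> x \<in> eigenspace H0 l \<Longrightarrow> x = (\<Sum>e\<in>B. cinner e x *\<^sub>C e)"

text \<open>Among the orthonormal sets of eigenvectors with eigenvalue in [0,N], whose sizes are
  uniformly bounded, take one of maximal size. If an eigenvector were not recovered from its
  coefficients, its normalized remainder would enlarge that set.\<close>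

lemma truncated_eigenbasis_exists:
  fixes H0 :: "'a::complex_hilbert_space operator"
  assumes sa: "self_adjoint_op H0" and cr: "compact_resolvent H0"
  obtains B ev where "truncated_eigenbasis H0 N B ev"
proof -
  define good where "good B \<longleftrightarrow> orthonormal_set B \<and> B \<subseteq> (\<Union>l\<in>{0..N}. eigenspace H0 l)" for B
  obtain K where K: "compact K"
    "\<And>x l. x \<in> eigenspace H0 l \<Longrightarrow> l \<in> {0..N} \<Longrightarrow> norm x = 1 \<Longrightarrow> x \<in> K"
    using unit_eigenvectors_relatively_compact[OF cr] by blast
  obtain n where n: "\<And>B. orthonormal_set B \<Longrightarrow> B \<subseteq> K \<Longrightarrow> finite B \<and> card B \<le> n"
    using orthonormal_card_bound[OF K(1)] by blast
  have goodn: "finite B \<and> card B \<le> n" if "good B" for B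
  proof (rule n)
    show "orthonormal_set B" using that by (simp add: good_def)
    then show "B \<subseteq> K" using that K(2) orthonormal_set_norm unfolding good_def by blast
  qed
  have "good {}" by (simp add: good_def orthonormal_set_def)
  moreover have "\<forall>B. good B \<longrightarrow> card B < Suc n" using goodn by (simp add: less_Suc_eq_le)
  ultimately obtain B where B: "good B" and Bmax: "\<And>C. good C \<Longrightarrow> card C \<le> card B"
    using ex_has_greatest_nat[of good "{}" card "Suc n"] by (metis (no_types, lifting) less_imp_le)
  have fB: "finite B" and oB: "orthonormal_set B" using goodn B by (auto simp: good_def)
  have "\<forall>e\<in>B. \<exists>l. l \<in> {0..N} \<and> e \<in> eigenspace H0 l" using B unfolding good_def by blast
  then obtain ev where ev: "\<And>e. e \<in> B \<Longrightarrow> ev e \<in> {0..N} \<and> e \<in> eigenspace H0 (ev e)" by metis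
  have "x = (\<Sum>e\<in>B. cinner e x *\<^sub>C e)" if l: "l \<in> {0..N}" and x: "x \<in> eigenspace H0 l" for l x
  proof (rule ccontr)
    assume neq: "x \<noteq> (\<Sum>e\<in>B. cinner e x *\<^sub>C e)"
    define y where "y = x - (\<Sum>e\<in>B. cinner e x *\<^sub>C e)"
    have sub: "complex_subspace (eigenspace H0 l)" by (rule complex_subspace_eigenspace[OF sa])
    \<comment> \<open>The remainder has to stay an eigenvector for \<open>l\<close>: basis vectors
      of another eigenvalue contribute nothing, as they are orthogonal to \<open>x\<close>.\<close>
    have "cinner e x *\<^sub>C e \<in> eigenspace H0 l" if "e \<in> B" for e
    proof (cases "ev e = l")
      case True
      with ev[OF that] sub show ?thesis by (auto simp: complex_subspace_def)
    next
      case False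
      with ev[OF that] x have "cinner e x = 0" using eigenspace_orthogonal[OF sa] by blast
      with sub show ?thesis by (simp add: complex_subspace_def)
    qed
    from complex_subspace_sum[OF sub this, of B "\<lambda>e. e" "\<lambda>_. 1"]
    have yl: "y \<in> eigenspace H0 l"
      unfolding y_def using complex_subspace_diff[OF sub x] by simp
    have y0: "y \<noteq> 0" using neq by (simp add: y_def)
    have ye: "cinner e y = 0" if "e \<in> B" for e
      using cinner_orthonormal_sum[OF oB fB order_refl that] that
      by (simp add: y_def cinner_diff_right)
    define z where "z = of_real (1 / norm y) *\<^sub>C y"
    have z: "z \<in> eigenspace H0 l" using sub yl unfolding z_def complex_subspace_def by blast
    have ze: "cinner e z = 0" "cinner z e = 0" if "e \<in> B" for e
      using ye[OF that] cinner_commute[of z e]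
      by (auto simp: z_def cinner_scaleC_right)
    have "norm z = 1" using y0 by (simp add: z_def norm_scaleC norm_divide)
    then have zz: "cinner z z = 1" by (simp add: cinner_self_eq_norm)
    have "z \<notin> B" using ze(1)[of z] zz by auto
    moreover have "good (insert z B)"
      using B l z ze zz unfolding good_def orthonormal_set_def by auto
    ultimately show False using Bmax[of "insert z B"] fB by simp
  qed
  with sa fB oB ev have "truncated_eigenbasis H0 N B ev" by unfold_locales auto
  with that show ?thesis .
qed

section \<open>The functional calculus in coordinates\<close>

context truncated_eigenbasis
begin

text \<open>The isomorphism from coordinates onto H_N, with inverse
  \<open>\<lambda>e. cinner e x\<close>. Values of \<open>a\<close> off \<open>B\<close> are
  ignored.\<close>

definition synth :: "('a \<Rightarrow> complex) \<Rightarrow> 'a" where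
  "synth a = (\<Sum>e\<in>B. a e *\<^sub>C e)"

lemma cinner_synth [simp]:
  assumes "e \<in> B"
  shows "cinner e (synth a) = a e"
  using cinner_orthonormal_sum[OF orthonormal_B finite_B order_refl assms, of a] assms
  by (simp only: synth_def if_True)

lemma synth_cong: "(\<And>e. e \<in> B \<Longrightarrow> a e = b e) \<Longrightarrow> synth a = synth b"
  by (simp add: synth_def)

lemma partial_sum_in_eigenspace: "(\<Sum>e | e \<in> B \<and> ev e = l. a e *\<^sub>C e) \<in> eigenspace H0 l"
proof (rule complex_subspace_sum[OF complex_subspace_eigenspace[OF self_adjoint]])
  show "e \<in> eigenspace H0 l" if "e \<in> {e. e \<in> B \<and> ev e = l}" for e
    using ev(1)[of e] that by blast
qed

text \<open>Eigenspaces of different eigenvalues are orthogonal, so only the terms with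
  \<open>ev e = l\<close> survive. No range is imposed on \<open>l\<close>, as powers of \<Lambda>
  sum over the whole spectrum.\<close>

lemma orth_proj_synth:
  "orth_proj (eigenspace H0 l) (synth a) = (\<Sum>e | e \<in> B \<and> ev e = l. a e *\<^sub>C e)"
proof (rule orth_proj_eqI[OF complex_subspace_eigenspace[OF self_adjoint] partial_sum_in_eigenspace])
  fix y assume y: "y \<in> eigenspace H0 l"
  have "cinner y (synth a) = (\<Sum>e\<in>B. cinner y (a e *\<^sub>C e))"
    by (simp add: synth_def cinner_sum_right)
  also have "\<dots> = (\<Sum>e | e \<in> B \<and> ev e = l. cinner y (a e *\<^sub>C e))"
    using finite_B eigenspace_orthogonal[OF self_adjoint y ev(1)]
    by (intro sum.mono_neutral_right) (auto simp: cinner_scaleC_right)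
  finally show "cinner y (synth a - (\<Sum>e | e \<in> B \<and> ev e = l. a e *\<^sub>C e)) = 0"
    by (simp add: cinner_diff_right cinner_sum_right)
qed

text \<open>Here \<open>x\<close> is arbitrary and \<open>l\<close> restricted: the test vector
  \<open>y\<close> is the one expanded in \<open>B\<close>, which \<open>complete\<close> allows for
  \<open>l\<close> in [0,N].\<close>

lemma orth_proj_low_eigenspace:
  assumes "l \<in> {0..N}"
  shows "orth_proj (eigenspace H0 l) x = (\<Sum>e | e \<in> B \<and> ev e = l. cinner e x *\<^sub>C e)"
proof (rule orth_proj_eqI[OF complex_subspace_eigenspace[OF self_adjoint] partial_sum_in_eigenspace])
  fix y assume y: "y \<in> eigenspace H0 l"
  let ?p = "\<Sum>e | e \<in> B \<and> ev e = l. cinner e x *\<^sub>C e"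
  have "cinner y (x - ?p) = (\<Sum>e\<in>B. cinner (cinner e y *\<^sub>C e) (x - ?p))"
    by (subst complete[OF assms y]) (rule cinner_sum_left)
  also have "\<dots> = 0"
  proof (rule sum.neutral, rule ballI)
    fix e assume e: "e \<in> B"
    show "cinner (cinner e y *\<^sub>C e) (x - ?p) = 0"
    proof (cases "ev e = l")
      case True
      have "cinner e ?p = cinner e x"
        using cinner_orthonormal_sum[OF orthonormal_B, of "{e \<in> B. ev e = l}" e "\<lambda>e. cinner e x"]
          finite_B e True by simp
      then show ?thesis by (simp add: cinner_scaleC_left cinner_diff_right)
    next
      case False
      then have "cinner e y = 0" using eigenspace_orthogonal[OF self_adjoint ev(1)[OF e] y] by simp
      then show ?thesis by simp
    qed
  qed
  finally show "cinner y (x - ?p) = 0" .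
qed

lemma ev_in_eigenvalues: "e \<in> B \<Longrightarrow> ev e \<in> eigenvalues H0"
  unfolding eigenvalues_def using ev(1) orthonormal_set_norm[OF orthonormal_B] by force

lemma spectral_proj_eq: "spectral_proj H0 N x = synth (\<lambda>e. cinner e x)"
proof -
  have "spectral_proj H0 N x =
      (\<Sum>\<^sub>\<infinity>l\<in>eigenvalues H0. indicator {0..N} l *\<^sub>R orth_proj (eigenspace H0 l) x)"
    by (simp add: spectral_proj_def fun_calc_def)
  also have "\<dots> = (\<Sum>\<^sub>\<infinity>l\<in>ev ` B. \<Sum>e | e \<in> B \<and> ev e = l. cinner e x *\<^sub>C e)"
  proof (rule infsum_cong_neutral)
    \<comment> \<open>Such a term vanishes for one of two reasons: outside [0,N] the indicator is
      zero, and inside no basis vector belongs to \<open>l\<close>, so the projection is an empty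
      sum.\<close>
    fix l assume l: "l \<in> eigenvalues H0 - ev ` B"
    then have *: "{e. e \<in> B \<and> ev e = l} = {}" by auto
    show "indicator {0..N} l *\<^sub>R orth_proj (eigenspace H0 l) x = 0"
      using orth_proj_low_eigenspace[of l x, unfolded *] by (cases "l \<in> {0..N}") auto
  next
    fix l assume "l \<in> eigenvalues H0 \<inter> ev ` B"
    then have "l \<in> {0..N}" using ev by auto
    then show "indicator {0..N} l *\<^sub>R orth_proj (eigenspace H0 l) x =
        (\<Sum>e | e \<in> B \<and> ev e = l. cinner e x *\<^sub>C e)"
      by (simp add: orth_proj_low_eigenspace)
  qed (use ev_in_eigenvalues in auto)
  also have "\<dots> = (\<Sum>l\<in>ev ` B. \<Sum>e | e \<in> B \<and> ev e = l. cinner e x *\<^sub>C e)"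
    using finite_B by simp
  also have "\<dots> = synth (\<lambda>e. cinner e x)"
    unfolding synth_def using finite_B by (intro sum.group) auto
  finally show ?thesis .
qed

lemma trunc_space_eq: "trunc_space H0 N = range synth"
proof -
  have "synth a = spectral_proj H0 N (synth a)" for a
    unfolding spectral_proj_eq by (rule synth_cong) simp
  then show ?thesis unfolding trunc_space_def using spectral_proj_eq by (auto simp: image_iff)
qed

lemma synth_cinner: "x \<in> trunc_space H0 N \<Longrightarrow> synth (\<lambda>e. cinner e x) = x"
  unfolding trunc_space_eq by (auto intro: synth_cong)

text \<open>Only finitely many terms of the defining series are nonzero, whatever the
  exponent.\<close>

lemma synth_in_dom_Lambda_pow: "synth a \<in> dom_op (Lambda_pow H0 s)"
proof -
  have "(\<lambda>l. (l powr s)\<^sup>2 * (norm (orth_proj (eigenspace H0 (l - 1)) (synth a)))\<^sup>2)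
      summable_on eigenvalues (Lambda H0)"
  proof (rule summable_on_cong_neutral[THEN iffD1, OF _ _ _ summable_on_finite])
    show "finite ((\<lambda>e. 1 + ev e) ` B \<inter> eigenvalues (Lambda H0))" using finite_B by simp
  next
    fix l assume l: "l \<in> eigenvalues (Lambda H0) - ((\<lambda>e. 1 + ev e) ` B \<inter> eigenvalues (Lambda H0))"
    then have *: "{e. e \<in> B \<and> ev e = l - 1} = {}" by force
    show "(l powr s)\<^sup>2 * (norm (orth_proj (eigenspace H0 (l - 1)) (synth a)))\<^sup>2 = 0"
      unfolding orth_proj_synth * by simp
  qed auto
  then show ?thesis by (simp add: Lambda_pow_def fun_calc_def eigenspace_Lambda)
qed

lemma trunc_space_smooth: "trunc_space H0 N \<subseteq> smooth_space H0"
  unfolding trunc_space_eq smooth_space_def sobolev_space_def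
  using synth_in_dom_Lambda_pow by auto

text \<open>Powers of \<Lambda> are diagonal in \<open>B\<close>. The series collapses to the
  eigenvalues \<open>1 + ev e\<close>, and regrouping by eigenvalue gives a sum over
  \<open>B\<close>.\<close>

lemma Lambda_pow_synth:
  "app_op (Lambda_pow H0 s) (synth a) = synth (\<lambda>e. of_real ((1 + ev e) powr s) * a e)"
proof -
  let ?f = "\<lambda>e. (1 + ev e) powr s *\<^sub>R (a e *\<^sub>C e)"
  have "app_op (Lambda_pow H0 s) (synth a) =
      (\<Sum>\<^sub>\<infinity>l\<in>eigenvalues (Lambda H0). l powr s *\<^sub>R (\<Sum>e | e \<in> B \<and> ev e = l - 1. a e *\<^sub>C e))"
    by (simp add: Lambda_pow_def fun_calc_def eigenspace_Lambda orth_proj_synth)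
  also have "\<dots> = (\<Sum>\<^sub>\<infinity>l\<in>(\<lambda>e. 1 + ev e) ` B. \<Sum>e | e \<in> B \<and> 1 + ev e = l. ?f e)"
  proof (rule infsum_cong_neutral)
    \<comment> \<open>Vacuous case: every \<open>1 + ev e\<close> is an eigenvalue of
      \<Lambda>.\<close>
    fix l assume "l \<in> (\<lambda>e. 1 + ev e) ` B - eigenvalues (Lambda H0)"
    moreover have "1 + ev e \<in> eigenvalues (Lambda H0)" if "e \<in> B" for e
      using ev_in_eigenvalues[OF that] by (simp add: eigenvalues_def eigenspace_Lambda)
    ultimately show "(\<Sum>e | e \<in> B \<and> 1 + ev e = l. ?f e) = 0" by blast
  next
    fix l assume "l \<in> eigenvalues (Lambda H0) - (\<lambda>e. 1 + ev e) ` B"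
    then have *: "{e. e \<in> B \<and> ev e = l - 1} = {}" by force
    show "l powr s *\<^sub>R (\<Sum>e | e \<in> B \<and> ev e = l - 1. a e *\<^sub>C e) = 0"
      unfolding * by simp
  next
    fix l
    have "{e. e \<in> B \<and> ev e = l - 1} = {e. e \<in> B \<and> 1 + ev e = l}" by auto
    then show "l powr s *\<^sub>R (\<Sum>e | e \<in> B \<and> ev e = l - 1. a e *\<^sub>C e) =
        (\<Sum>e | e \<in> B \<and> 1 + ev e = l. ?f e)"
      by (auto simp: scaleR_sum_right intro!: sum.cong)
  qed
  also have "\<dots> = (\<Sum>l\<in>(\<lambda>e. 1 + ev e) ` B. \<Sum>e | e \<in> B \<and> 1 + ev e = l. ?f e)"
    using finite_B by simp
  also have "\<dots> = (\<Sum>e\<in>B. ?f e)" using finite_B by (intro sum.group) auto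
  finally show ?thesis
    by (simp add: synth_def scaleC_scaleC flip: scaleC_complex_of_real)
qed

lemma cinner_synth_left: "cinner (synth a) x = (\<Sum>e\<in>B. cnj (a e) * cinner e x)"
  by (simp add: synth_def cinner_sum_left cinner_scaleC_left)

lemma norm_synth: "(norm (synth a))\<^sup>2 = (\<Sum>e\<in>B. (cmod (a e))\<^sup>2)"
proof -
  have "complex_of_real ((norm (synth a))\<^sup>2) = of_real (\<Sum>e\<in>B. (cmod (a e))\<^sup>2)"
    unfolding cinner_self_eq_norm[symmetric] of_real_sum complex_norm_square
    by (simp add: cinner_synth_left mult.commute)
  then show ?thesis by (simp only: of_real_eq_iff)
qed

lemma sobolev_norm_synth:
  "(sobolev_norm H0 s (synth a))\<^sup>2 = (\<Sum>e\<in>B. (1 + ev e) powr (2 * s) * (cmod (a e))\<^sup>2)"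
proof -
  have "(x powr s)\<^sup>2 = x powr (2 * s)" for x :: real
    by (simp only: power2_eq_square powr_add[symmetric] mult_2)
  then show ?thesis
    unfolding sobolev_norm_def Lambda_pow_synth norm_synth
    by (simp only: norm_mult power_mult_distrib norm_of_real power2_abs)
qed

lemma basis_in_trunc_space:
  assumes "e \<in> B"
  shows "e \<in> trunc_space H0 N"
proof -
  have "synth (\<lambda>e'. if e' = e then 1 else 0) = (\<Sum>e'\<in>B. if e' = e then e' else 0)"
    unfolding synth_def by (intro sum.cong) auto
  also have "\<dots> = e" using finite_B assms by simp
  finally show ?thesis unfolding trunc_space_eq by (metis rangeI)
qed

text \<open>By linearity on its domain, the operator acts on H_N through its values on the finitely
  many basis vectors, all of which are smooth.\<close>

lemma symmetric_op_synth:
  assumes "symmetric_op A" "smooth_space H0 \<subseteq> dom_op A"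
  shows "cinner x (app_op A (synth a)) = (\<Sum>j\<in>B. cinner x (app_op A j) * a j)"
proof -
  have "app_op A (synth a) = (\<Sum>j\<in>B. a j *\<^sub>C app_op A j)"
    unfolding synth_def
  proof (rule complex_linear_on_sum)
    show "complex_subspace (dom_op A)" "complex_linear_on (dom_op A) (app_op A)"
      using assms(1) by (auto simp: symmetric_op_def)
    show "e \<in> dom_op A" if "e \<in> B" for e
      using basis_in_trunc_space[OF that] trunc_space_smooth assms(2) by blast
  qed
  then show ?thesis by (simp add: cinner_sum_right cinner_scaleC_right mult.commute)
qed

end

section \<open>Analytic tools: the commutator form, a common null set, a logarithmic Gronwall
  estimate\<close>

lemma cmod_commutator_form:
  "cmod (\<i> * (cinner x y - cinner y x)) = \<bar>2 * Im (cinner (y::'a::complex_hilbert_space) x)\<bar>"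
proof -
  have "\<i> * (cinner x y - cinner y x) = of_real (2 * Im (cinner y x))"
    by (subst cinner_commute[of x y]) (simp add: complex_eq_iff)
  then show ?thesis by (metis norm_of_real real_norm_def)
qed

text \<open>Separability of \<open>\<complex>\<^sup>B\<close> lets the exceptional null set be chosen independently of \<open>x\<close>.\<close>

lemma AE_all_coordinates:
  fixes F :: "'t \<Rightarrow> ('b \<Rightarrow> complex) \<Rightarrow> real"
  assumes fin: "finite B"
    and cont: "\<And>t x X. t \<in> I \<Longrightarrow> (\<And>e. e \<in> B \<Longrightarrow> (\<lambda>n. X n e) \<longlonglongrightarrow> x e) \<Longrightarrow> (\<lambda>n. F t (X n)) \<longlonglongrightarrow> F t x"
    and ae: "\<And>x. AE t in M. t \<in> I \<longrightarrow> F t x \<le> 0"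
  shows "AE t in M. t \<in> I \<longrightarrow> (\<forall>x. F t x \<le> 0)"
proof -
  obtain C :: "complex set" where C: "countable C" "\<And>X. open X \<Longrightarrow> X \<noteq> {} \<Longrightarrow> \<exists>d\<in>C. d \<in> X"
    using countable_dense_exists by (metis (no_types, lifting))
  \<comment> \<open>Extensional functions have a fixed value off \<open>B\<close>; without this
    \<open>D\<close> need not be countable. The approximants below are restricted to
    \<open>B\<close> for the same reason, and \<open>cont\<close> asks for convergence on
    \<open>B\<close> only.\<close>
  define D where "D = (\<Pi>\<^sub>E e\<in>B. C)"
  have "countable D" unfolding D_def by (intro countable_PiE fin C(1))
  then have "AE t in M. \<forall>x\<in>D. t \<in> I \<longrightarrow> F t x \<le> 0"
    using ae by (subst AE_ball_countable) auto
  then show ?thesis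
  proof (rule AE_mp, intro AE_I2 impI allI)
    fix t and x :: "'b \<Rightarrow> complex"
    assume D: "\<forall>x\<in>D. t \<in> I \<longrightarrow> F t x \<le> 0" and t: "t \<in> I"
    have "\<exists>d\<in>C. d \<in> ball (x e) (1 / real (Suc n))" for n e by (rule C(2)) auto
    then have "\<forall>n e. \<exists>d. d \<in> C \<and> d \<in> ball (x e) (1 / real (Suc n))" by blast
    then obtain d where d: "\<And>n e. d n e \<in> C" "\<And>n e. d n e \<in> ball (x e) (1 / real (Suc n))" by metis
    define X where "X n = restrict (d n) B" for n
    have "X n \<in> D" for n using d(1) by (auto simp: X_def D_def)
    then have "F t (X n) \<le> 0" for n using D t by blast
    moreover have "(\<lambda>n. F t (X n)) \<longlonglongrightarrow> F t x"
    proof (rule cont[OF t])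
      fix e assume "e \<in> B"
      then have "dist (X n e) (x e) \<le> 1 / real (Suc n)" for n
        using d(2)[of n e] by (simp add: X_def dist_commute less_imp_le)
      then show "(\<lambda>n. X n e) \<longlonglongrightarrow> x e"
        by (intro metric_tendsto_imp_tendsto[OF LIMSEQ_inverse_real_of_nat])
          (simp add: inverse_eq_divide)
    qed
    ultimately show "F t x \<le> 0" by (intro LIMSEQ_le_const2) auto
  qed
qed

text \<open>The derivative of \<open>ln S\<close> is \<open>S' / S\<close>, bounded by
  \<open>c\<close> in absolute value almost everywhere. The fundamental theorem is applied to this
  continuous quotient, not to \<open>c\<close>, which is merely integrable; the absolute value
  covers growth and decay alike.\<close>

lemma gronwall_log_AE:
  fixes S S' c :: "real \<Rightarrow> real"
  assumes ab: "a \<le> b" and pos: "\<And>t. t \<in> {a..b} \<Longrightarrow> S t > 0"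
    and deriv: "\<And>t. t \<in> {a..b} \<Longrightarrow> (S has_vector_derivative S' t) (at t within {a..b})"
    and cont: "continuous_on {a..b} S'"
    and int: "set_integrable lebesgue {a..b} c"
    and ae: "AE t in lebesgue. t \<in> {a..b} \<longrightarrow> \<bar>S' t\<bar> \<le> c t * S t"
  shows "\<bar>ln (S b) - ln (S a)\<bar> \<le> (LINT t:{a..b}|lebesgue. c t)"
proof -
  have S: "continuous_on {a..b} S"
    using deriv has_vector_derivative_continuous continuous_on_eq_continuous_within by blast
  let ?g = "\<lambda>t. S' t / S t"
  have "continuous_on {a..b} ?g"
    using pos by (intro continuous_on_divide cont S) force
  then have g: "set_integrable lebesgue {a..b} ?g" by (rule absolutely_integrable_continuous_real)
  have "(?g has_integral ln (S b) - ln (S a)) {a..b}"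
  proof (rule fundamental_theorem_of_calculus[OF ab])
    fix t assume t: "t \<in> {a..b}"
    have "((\<lambda>t. ln (S t)) has_real_derivative S' t * inverse (S t)) (at t within {a..b})"
      using deriv[OF t] pos[OF t] unfolding has_real_derivative_iff_has_vector_derivative[symmetric]
      by (auto intro!: derivative_eq_intros simp: divide_inverse)
    then show "((\<lambda>t. ln (S t)) has_vector_derivative ?g t) (at t within {a..b})"
      by (simp add: has_real_derivative_iff_has_vector_derivative divide_inverse)
  qed
  then have "ln (S b) - ln (S a) = (LINT t:{a..b}|lebesgue. ?g t)"
    by (metis set_lebesgue_integral_eq_integral(2)[OF g] integral_unique)
  also have "\<bar>\<dots>\<bar> \<le> (LINT t:{a..b}|lebesgue. \<bar>?g t\<bar>)"
    using set_integral_norm_bound[OF g] by simp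
  also have "\<dots> \<le> (LINT t:{a..b}|lebesgue. c t)"
  proof (rule set_integral_mono_AE[OF set_integrable_abs[OF g] int])
    show "AE t\<in>{a..b} in lebesgue. \<bar>?g t\<bar> \<le> c t"
      using ae by eventually_elim (use pos in \<open>auto simp: abs_div_pos[symmetric] pos_divide_le_eq simp del: abs_divide\<close>)
  qed
  finally show ?thesis .
qed

section \<open>The stability estimate for the truncated propagators\<close>

theorem proposition3p17:
  fixes H0 :: "'a::complex_hilbert_space operator"
    and H :: "real \<Rightarrow> 'a operator"
    and I :: "real set" and r :: real and c :: "real \<Rightarrow> real"
  assumes "separable_space (euclidean :: 'a topology)"
    and "self_adjoint_op H0" and "positive_op H0"
    and "spectrum_op H0 \<subseteq> complex_of_real ` {0..}"
    and "compact_resolvent H0"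
    and "is_interval I"
    and "r \<ge> 0"
    and "\<forall>t\<in>I. symmetric_op (H t)"
    and "\<forall>t\<in>I. smooth_space H0 \<subseteq> dom_op (H t)"
    and "\<forall>u\<in>smooth_space H0. continuous_on I (\<lambda>t. app_op (H t) u)"
    and "\<forall>t\<in>I. c t \<ge> 0"
    and "locally_integrable_on c I"
    and "\<forall>v\<in>smooth_space H0. AE t in lebesgue. t \<in> I \<longrightarrow>
           cmod (\<i> * (cinner (app_op (H t) v) (app_op (Lambda_pow H0 (2 * r)) v)
                    - cinner (app_op (Lambda_pow H0 (2 * r)) v) (app_op (H t) v)))
             \<le> c t * (sobolev_norm H0 r v)\<^sup>2"
  shows "\<forall>N>0. \<forall>U.
           unitary_propagator I (trunc_space H0 N) (trunc_hamiltonian H0 H N) U \<longrightarrow>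
           (\<forall>v\<in>trunc_space H0 N. \<forall>s\<in>I. \<forall>t\<in>I.
              sobolev_norm H0 r (U t s v)
                \<le> exp (1 / 2 * (LINT \<tau>:{min s t..max s t}|lebesgue. c \<tau>))
                    * sobolev_norm H0 r v)"
proof (intro allI impI ballI)
  fix N U v s t
  assume U: "unitary_propagator I (trunc_space H0 N) (trunc_hamiltonian H0 H N) U"
    and v: "v \<in> trunc_space H0 N" and s: "s \<in> I" and t: "t \<in> I"
  obtain B ev where "truncated_eigenbasis H0 N B ev"
    using truncated_eigenbasis_exists[OF assms(2,5)] by blast
  then interpret truncated_eigenbasis H0 N B ev .
  \<comment> \<open>In coordinates: \<open>w\<close> is the diagonal of
    \<open>Lambda_pow H0 (2 * r)\<close>, \<open>h\<close> the matrix of the Hamiltonian,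
    \<open>S\<close> the squared Sobolev norm, and \<open>G\<close> the commutator form, written as
    twice the imaginary part of one inner product.\<close>
  define w where "w e = (1 + ev e) powr (2 * r)" for e
  define h where "h \<tau> i j = cinner i (app_op (H \<tau>) j)" for \<tau> i j
  define S where "S x = (\<Sum>e\<in>B. w e * (cmod (x e))\<^sup>2)" for x
  define G where "G \<tau> x = 2 * Im (\<Sum>i\<in>B. of_real (w i) * cnj (x i) * (\<Sum>j\<in>B. h \<tau> i j * x j))"
    for \<tau> and x :: "'a \<Rightarrow> complex"
  have w: "w e > 0" if "e \<in> B" for e using ev(2)[OF that] by (simp add: w_def)
  have S_eq: "S x = (sobolev_norm H0 r (synth x))\<^sup>2" for x
    by (simp add: S_def w_def sobolev_norm_synth)
  have H_synth: "cinner y (app_op (H \<tau>) (synth x)) = (\<Sum>j\<in>B. cinner y (app_op (H \<tau>) j) * x j)"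
    if "\<tau> \<in> I" for \<tau> x y
    using symmetric_op_synth assms(8,9) that by blast
  have G_eq: "cmod (\<i> * (cinner (app_op (H \<tau>) (synth x)) (app_op (Lambda_pow H0 (2 * r)) (synth x))
      - cinner (app_op (Lambda_pow H0 (2 * r)) (synth x)) (app_op (H \<tau>) (synth x)))) = \<bar>G \<tau> x\<bar>"
    if "\<tau> \<in> I" for \<tau> x
  proof -
    have "cinner (app_op (Lambda_pow H0 (2 * r)) (synth x)) (app_op (H \<tau>) (synth x)) =
        (\<Sum>i\<in>B. of_real (w i) * cnj (x i) * cinner i (app_op (H \<tau>) (synth x)))"
      unfolding Lambda_pow_synth cinner_synth_left by (simp add: w_def)
    then show ?thesis
      unfolding cmod_commutator_form by (simp only: G_def h_def H_synth[OF that])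
  qed
  \<comment> \<open>The quantifier over \<open>x\<close> must stand inside the almost-everywhere
    statement, since the bound will be used at a vector that moves with the time.\<close>
  have ae: "AE \<tau> in lebesgue. \<tau> \<in> I \<longrightarrow> (\<forall>x. \<bar>G \<tau> x\<bar> - c \<tau> * S x \<le> 0)"
  proof (rule AE_all_coordinates[OF finite_B])
    fix \<tau> x and X :: "nat \<Rightarrow> 'a \<Rightarrow> complex"
    assume "\<And>e. e \<in> B \<Longrightarrow> (\<lambda>n. X n e) \<longlonglongrightarrow> x e"
    then show "(\<lambda>n. \<bar>G \<tau> (X n)\<bar> - c \<tau> * S (X n)) \<longlonglongrightarrow> \<bar>G \<tau> x\<bar> - c \<tau> * S x"
      unfolding G_def S_def by (intro tendsto_intros)
  next
    fix x
    have "synth x \<in> smooth_space H0" using trunc_space_smooth trunc_space_eq by auto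
    from bspec[OF assms(13) this]
    show "AE \<tau> in lebesgue. \<tau> \<in> I \<longrightarrow> \<bar>G \<tau> x\<bar> - c \<tau> * S x \<le> 0"
      by eventually_elim (simp add: G_eq S_eq)
  qed

  define x where "x \<tau> e = cinner e (U \<tau> s v)" for \<tau> e
  have unitary: "unitary_on (trunc_space H0 N) (U \<tau> s)" if "\<tau> \<in> I" for \<tau>
    using U s that by (simp add: unitary_propagator_def)
  have UW: "U \<tau> s v \<in> trunc_space H0 N" if "\<tau> \<in> I" for \<tau>
    using unitary[OF that] v unfolding unitary_on_def bij_betw_def by blast
  have synth_x: "synth (x \<tau>) = U \<tau> s v" if "\<tau> \<in> I" for \<tau>
    using synth_cinner[OF UW[OF that]] by (simp add: x_def[abs_def])
  have dx: "((\<lambda>\<tau>. x \<tau> e) has_vector_derivative - \<i> * (\<Sum>j\<in>B. h \<tau> e j * x \<tau> j)) (at \<tau> within I)"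
    if \<tau>: "\<tau> \<in> I" and e: "e \<in> B" for \<tau> e
  proof -
    obtain D where D: "((\<lambda>\<tau>. U \<tau> s v) has_vector_derivative D) (at \<tau> within I)"
      and iD: "\<i> *\<^sub>C D = trunc_hamiltonian H0 H N \<tau> (U \<tau> s v)"
      using U s v \<tau> unfolding unitary_propagator_def by blast
    \<comment> \<open>The inner projection fixes \<open>U \<tau> s v\<close>, and the outer one
      preserves coordinates in \<open>B\<close>; the evolution becomes a linear system with matrix
      \<open>h\<close>.\<close>
    have "\<i> *\<^sub>C D = synth (\<lambda>e. cinner e (app_op (H \<tau>) (synth (x \<tau>))))"
      unfolding iD trunc_hamiltonian_def spectral_proj_eq by (simp add: x_def[abs_def])
    then have "\<i> * cinner e D = cinner e (app_op (H \<tau>) (synth (x \<tau>)))"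
      unfolding cinner_scaleC_right[symmetric] by (simp only: cinner_synth[OF e])
    also have "\<dots> = (\<Sum>j\<in>B. h \<tau> e j * x \<tau> j)"
      unfolding H_synth[OF \<tau>] h_def ..
    finally have "- \<i> * (\<i> * cinner e D) = - \<i> * (\<Sum>j\<in>B. h \<tau> e j * x \<tau> j)"
      by (rule arg_cong)
    then have "cinner e D = - \<i> * (\<Sum>j\<in>B. h \<tau> e j * x \<tau> j)"
      by (simp add: mult.assoc[symmetric] del: mult_minus_left)
    with bounded_linear.has_vector_derivative[OF bounded_linear_cinner D, of e]
    show ?thesis by (simp add: x_def)
  qed
  have cx: "continuous_on I (\<lambda>\<tau>. x \<tau> e)" if "e \<in> B" for e
    using dx[OF _ that] has_vector_derivative_continuous continuous_on_eq_continuous_within by blast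
  have ch: "continuous_on I (\<lambda>\<tau>. h \<tau> i j)" if "j \<in> B" for i j
    unfolding h_def using assms(10) basis_in_trunc_space[OF that] trunc_space_smooth
    by (intro bounded_linear.continuous_on[OF bounded_linear_cinner]) blast
  have cG: "continuous_on I (\<lambda>\<tau>. G \<tau> (x \<tau>))"
    unfolding G_def by (intro continuous_intros cx ch)
  \<comment> \<open>With \<open>z' = - \<i> * u\<close>, the derivative of the squared modulus of
    \<open>z\<close> is \<open>2 * Im (cnj z * u)\<close>; summing with the real weights
    \<open>w\<close> gives exactly \<open>G\<close>.\<close>
  have dS: "((\<lambda>\<tau>. S (x \<tau>)) has_vector_derivative G \<tau> (x \<tau>)) (at \<tau> within I)" if \<tau>: "\<tau> \<in> I" for \<tau>
  proof -
    let ?y = "\<lambda>e. \<Sum>j\<in>B. h \<tau> e j * x \<tau> j"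
    have "((\<lambda>\<tau>. w e * inner (x \<tau> e) (x \<tau> e)) has_vector_derivative
        w e * (2 * Im (cnj (x \<tau> e) * ?y e))) (at \<tau> within I)" if e: "e \<in> B" for e
    proof -
      have "((\<lambda>\<tau>. w e * inner (x \<tau> e) (x \<tau> e)) has_vector_derivative
          w e * (inner (x \<tau> e) (- \<i> * ?y e) + inner (- \<i> * ?y e) (x \<tau> e))) (at \<tau> within I)"
        by (intro bounded_linear.has_vector_derivative[OF bounded_linear_mult_right]
            bounded_bilinear.has_vector_derivative[OF bounded_bilinear_inner] dx \<tau> e)
      moreover have "inner z (- \<i> * u) + inner (- \<i> * u) z = 2 * Im (cnj z * u)" for z u
        by (simp add: inner_complex_def)
      ultimately show ?thesis by simp
    qed
    then have "((\<lambda>\<tau>. \<Sum>e\<in>B. w e * inner (x \<tau> e) (x \<tau> e)) has_vector_derivative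
        (\<Sum>e\<in>B. w e * (2 * Im (cnj (x \<tau> e) * ?y e)))) (at \<tau> within I)"
      by (rule has_vector_derivative_sum)
    moreover have "(\<Sum>e\<in>B. w e * (2 * Im (cnj (x \<tau> e) * ?y e))) = G \<tau> (x \<tau>)"
    proof -
      have "Im (of_real a * z * u) = a * Im (z * u)" for a z u by (simp add: algebra_simps)
      then have "G \<tau> (x \<tau>) = 2 * (\<Sum>e\<in>B. w e * Im (cnj (x \<tau> e) * ?y e))"
        by (simp only: G_def Im_sum)
      also have "\<dots> = (\<Sum>e\<in>B. w e * (2 * Im (cnj (x \<tau> e) * ?y e)))"
        by (simp only: sum_distrib_left[of 2] mult.left_commute)
      finally show ?thesis ..
    qed
    ultimately show ?thesis unfolding S_def power2_norm_eq_inner by simp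
  qed

  show "sobolev_norm H0 r (U t s v)
      \<le> exp (1 / 2 * (LINT \<tau>:{min s t..max s t}|lebesgue. c \<tau>)) * sobolev_norm H0 r v"
  proof -
    let ?J = "{min s t..max s t}" and ?L = "LINT \<tau>:{min s t..max s t}|lebesgue. c \<tau>"
    have J: "?J \<subseteq> I"
    proof
      fix \<tau> assume "\<tau> \<in> ?J"
      then have \<tau>: "min s t \<le> \<tau>" "\<tau> \<le> max s t" by simp_all
      have "min s t \<in> I" "max s t \<in> I" using s t by (simp_all add: min_def max_def)
      with assms(6) \<tau> show "\<tau> \<in> I" unfolding is_interval_1 by metis
    qed
    have Us: "U s s v = v" using U s v by (simp add: unitary_propagator_def)
    have "S (x t) \<le> exp ?L * S (x s)"
    \<comment> \<open>The logarithm needs \<open>S > 0\<close>. For \<open>v = 0\<close> both sides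
      are zero; otherwise unitarity keeps \<open>U \<tau> s v\<close> nonzero, so some coordinate is
      nonzero, and its weight is positive.\<close>
    proof (cases "v = 0")
      case True
      have "cinner (U t s v) (U t s v) = cinner v v"
        using unitary[OF t] v by (simp add: unitary_on_def)
      then have "U t s v = 0" using True by (simp add: cinner_self_eq_0_iff)
      then show ?thesis using True Us by (simp add: S_def x_def)
    next
      case False
      have pos: "S (x \<tau>) > 0" if \<tau>: "\<tau> \<in> I" for \<tau>
      proof -
        have "cinner (U \<tau> s v) (U \<tau> s v) = cinner v v"
          using unitary[OF \<tau>] v by (simp add: unitary_on_def)
        then have "synth (x \<tau>) \<noteq> 0"
          using False unfolding synth_x[OF \<tau>] by (auto simp: cinner_self_eq_0_iff)
        then have "\<exists>e\<in>B. x \<tau> e *\<^sub>C e \<noteq> 0"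
          unfolding synth_def by (meson sum.neutral)
        then obtain e where e: "e \<in> B" "x \<tau> e \<noteq> 0" by (metis scaleC_zero_left)
        show ?thesis unfolding S_def
          by (rule sum_pos2[OF finite_B e(1)]) (use e w in \<open>auto simp: less_imp_le\<close>)
      qed
      \<comment> \<open>Bounding the absolute difference between the ordered end points settles both
        \<open>s \<le> t\<close> and \<open>t \<le> s\<close>.\<close>
      have "\<bar>ln (S (x (max s t))) - ln (S (x (min s t)))\<bar> \<le> ?L"
      proof (rule gronwall_log_AE[where S' = "\<lambda>\<tau>. G \<tau> (x \<tau>)"])
        show "set_integrable lebesgue ?J c"
          using assms(12) J by (simp add: locally_integrable_on_def)
        show "AE \<tau> in lebesgue. \<tau> \<in> ?J \<longrightarrow> \<bar>G \<tau> (x \<tau>)\<bar> \<le> c \<tau> * S (x \<tau>)"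
          using ae by eventually_elim (use J in auto)
        show "continuous_on ?J (\<lambda>\<tau>. G \<tau> (x \<tau>))" by (rule continuous_on_subset[OF cG J])
        show "((\<lambda>\<tau>. S (x \<tau>)) has_vector_derivative G \<tau> (x \<tau>)) (at \<tau> within ?J)" if "\<tau> \<in> ?J" for \<tau>
          by (rule has_vector_derivative_within_subset[OF dS J]) (rule subsetD[OF J that])
      qed (use pos J in auto)
      then have "ln (S (x t)) \<le> ?L + ln (S (x s))"
        by (auto simp: min_def max_def split: if_splits)
      also have "\<dots> = ln (exp ?L * S (x s))" using pos[OF s] by (simp add: ln_mult)
      finally show ?thesis using pos[OF s] pos[OF t] by simp
    qed
    \<comment> \<open>The factor 1/2 arises because \<open>S\<close> is the square of the
      norm.\<close>
    also have "exp ?L = (exp (1 / 2 * ?L))\<^sup>2" by (simp add: power2_eq_square flip: exp_add)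
    finally have "(sobolev_norm H0 r (U t s v))\<^sup>2 \<le> (exp (1 / 2 * ?L) * sobolev_norm H0 r v)\<^sup>2"
      using synth_x[OF s] synth_x[OF t] Us by (simp add: S_eq power_mult_distrib)
    then show ?thesis
      by (rule power2_le_imp_le) (simp add: sobolev_norm_def)
  qed
qed

end
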